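(* Let $q$ be a prime power and let $k,s,t,g,h$ be positive integers with $\gcd(5,s)=\gcd(5,t)=1$ and $k\in\{2,3\}$. Let $\eta,\theta\in\mathbb{F}_{q^5}^*$ satisfy $N_{q^{5s}/q^s}(\eta)\neq(-1)^{5k}$ and $N_{q^{5t}/q^t}(\theta)\neq(-1)^{5k}$. Assume $s\not\equiv\pm t\pmod 5$. Then $\mathcal{H}_{k,s}(\eta,g)$ and $\mathcal{H}_{k,t}(\theta,h)$ are not equivalent.
   Context: Here $n=5$. All polynomials are $q$-polynomials over $\mathbb{F}_{q^5}$, i.e. $\sum_{i=0}^{4}a_ix^{q^i}$ with $a_i\in\mathbb{F}_{q^5}$, considered modulo $x^{q^5}-x$. $N_{q^{5s}/q^s}(\eta)=\eta^{1+q^s+q^{2s}+q^{3s}+q^{4s}}$. For integers $k,s,h$ and $\eta\in\mathbb{F}_{q^5}$, $\mathcal{H}_{k,s}(\eta,h)=\{a_0x+a_1x^{q^s}+\dots+a_{k-1}x^{q^{s(k-1)}}+\eta a_0^{q^h}x^{q^{sk}} : a_0,\dots,a_{k-1}\in\mathbb{F}_{q^5}\}$. Two sets $\mathcal{C},\mathcal{C}'$ of $q$-polynomials over $\mathbb{F}_{q^5}$ are equivalent if there exist permutation $q$-polynomials $L_1,L_2$ (inducing bijections of $\mathbb{F}_{q^5}$) and $\rho\in\mathrm{Aut}(\mathbb{F}_q)$ with $\mathcal{C}'=\{L_1\circ f^\rho\circ L_2: f\in\mathcal{C}\}$, where $(\sum a_ix^{q^i})^\rho:=\sum a_i^\rho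 x^{q^i}$. *)

theory Defs
  imports
    "HOL-Library.Cardinality"
    "HOL-Computational_Algebra.Polynomial"
    "HOL-Number_Theory.Cong"
    "HOL-Number_Theory.Prime_Powers"
begin

text \<open>Throughout, the type \<open>'a\<close> plays the role of the finite field with \<open>q ^ 5\<close> elements;
  the theorem assumes \<open>CARD('a) = q ^ 5\<close>.\<close>

definition subfield_Fq :: "nat \<Rightarrow> 'a::field set" where
  "subfield_Fq q = {x. x ^ q = x}"

definition automorphism_on :: "'a::field set \<Rightarrow> ('a \<Rightarrow> 'a) \<Rightarrow> bool" where
  "automorphism_on K \<sigma> \<longleftrightarrow> bij_betw \<sigma> K K \<and>
     (\<forall>x\<in>K. \<forall>y\<in>K. \<sigma> (x + y) = \<sigma> x + \<sigma> y \<and> \<sigma> (x * y) = \<sigma> x * \<sigma> y)"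

text \<open>Reduction modulo \<open>x ^ (q ^ 5) - x\<close>. A class of polynomials is represented by its unique
  member of degree less than \<open>q ^ 5\<close>.\<close>

definition red :: "nat \<Rightarrow> 'a::field poly \<Rightarrow> 'a poly" where
  "red q f = f mod (monom 1 (q ^ 5) - monom 1 1)"

definition qpolys :: "nat \<Rightarrow> 'a::field poly set" where
  "qpolys q = {\<Sum>i<5. monom (a i) (q ^ i) | a :: nat \<Rightarrow> 'a. True}"

definition permutation_qpoly :: "nat \<Rightarrow> 'a::field poly \<Rightarrow> bool" where
  "permutation_qpoly q L \<longleftrightarrow> L \<in> qpolys q \<and> bij (poly L)"

definition norm5 :: "nat \<Rightarrow> nat \<Rightarrow> 'a::field \<Rightarrow> 'a" where
  "norm5 q s \<eta> = \<eta> ^ (\<Sum>i<5. q ^ (i * s))"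

definition Hcode :: "nat \<Rightarrow> nat \<Rightarrow> nat \<Rightarrow> 'a::field \<Rightarrow> nat \<Rightarrow> 'a poly set" where
  "Hcode q k s \<eta> h =
     {red q ((\<Sum>i<k. monom (a i) (q ^ (s * i))) + monom (\<eta> * a 0 ^ (q ^ h)) (q ^ (s * k)))
      | a :: nat \<Rightarrow> 'a. True}"

text \<open>An automorphism \<open>\<rho>\<close> of \<open>subfield_Fq q\<close> acts on coefficients in the whole field through an
  extension \<open>\<sigma>\<close> of it. Two extensions of \<open>\<rho>\<close> differ by a power of \<open>x \<mapsto> x ^ q\<close>, and
  applying that power to the coefficients is conjugation by a permutation \<open>q\<close>-polynomial
  \<open>x ^ (q ^ i)\<close>, so the relation does not depend on which extension is used.\<close>

definition code_equivalent :: "nat \<Rightarrow> 'a::field poly set \<Rightarrow> 'a poly set \<Rightarrow> bool" where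
  "code_equivalent q C C' \<longleftrightarrow>
     (\<exists>L1 L2 \<rho> \<sigma>. permutation_qpoly q L1 \<and> permutation_qpoly q L2 \<and>
        automorphism_on (subfield_Fq q) \<rho> \<and>
        automorphism_on UNIV \<sigma> \<and> (\<forall>x\<in>subfield_Fq q. \<sigma> x = \<rho> x) \<and>
        C' = {red q (pcompose L1 (pcompose (map_poly \<sigma> f) L2)) | f. f \<in> C})"

end

theory Submission
  imports Defs "HOL-Library.Numeral_Type"
begin

text \<open>
  Write \<open>\<phi>\<^sub>i(x) = x^(q^(s i))\<close> with \<open>i\<close> in \<open>\<int>/5\<close>. As \<open>t \<equiv> \<plusminus>2s\<close> modulo 5, both codes are
  expressed through the \<open>\<phi>\<^sub>i\<close>, and an equivalence gives nonzero maps \<open>L\<^sub>1 = \<Sum> l\<^sub>i \<phi>\<^sub>i\<close> and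
  \<open>L\<^sub>2 = \<Sum> m\<^sub>j \<phi>\<^sub>j\<close> such that \<open>L\<^sub>1 \<circ> f \<circ> L\<^sub>2\<close> lies in the second code for all \<open>f\<close> in the
  first one, after \<open>\<eta>\<close> has been replaced by its image under the field automorphism.

  Put \<open>S = {i. l\<^sub>i \<noteq> 0}\<close>, \<open>T = {i. m\<^sub>-\<^sub>i \<noteq> 0}\<close> and \<open>P\<^sub>d = {i \<in> S. i + d \<in> T}\<close>. By the linear
  independence of the \<open>\<phi>\<^sub>i\<close>, two of the sets \<open>P\<^sub>d\<close> are empty and the other three are translates
  of each other. Hence 3 divides \<open>|S| |T|\<close>, while \<open>T\<close> avoids two distinct translates of \<open>S\<close>,
  so that \<open>|S| + |T| \<le> 4\<close>. Therefore \<open>S\<close> or \<open>T\<close> is a singleton, and in each of these two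
  cases the remaining coefficient equations force the norm of \<open>\<eta>\<close> to be \<open>(-1)^k\<close>.
\<close>

section \<open>Arithmetic and difference counting in Z/5\<close>

lemma UNIV_5: "(UNIV :: 5 set) = {0, 1, 2, 3, 4}"
proof (rule sym, rule card_subset_eq)
  show "card {0, 1, 2, 3, 4 :: 5} = CARD(5)"
    by simp
qed auto

lemma numerals_5: "(5 :: 5) = 0" "(6 :: 5) = 1" "(7 :: 5) = 2" "(8 :: 5) = 3" "(9 :: 5) = 4" "- 1 = (4 :: 5)" "- 2 = (3 :: 5)"
  by simp_all

text \<open>Sorting the pairs of S x T by their difference gives
  \<open>card S * card T = 3 * card (P a)\<close>. The two empty differences make T disjoint from
  two translates of S, which bounds the sum of the cardinalities by 4. As 3 divides one of them,
  that one is 3 and the other is 1.\<close>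

lemma card_eq_1_of_three_differences:
  fixes S T :: "5 set"
  defines "P \<equiv> \<lambda>d. {i \<in> S. i + d \<in> T}"
  assumes UNIV: "UNIV = {a, b, c, e, f}" and dist: "distinct [a, b, c, e, f]"
    and empty: "P e = {}" "P f = {}"
    and card: "card (P b) = card (P a)" "card (P c) = card (P a)"
    and "S \<noteq> {}" "T \<noteq> {}"
  shows "card S = 1 \<or> card T = 1"
proof -
  have fin: "finite X" for X :: "5 set"
    by simp
  have "card S * card T = card (S \<times> T)"
    by (simp add: card_cartesian_product)
  also have "S \<times> T = (\<Union>d\<in>UNIV. (\<lambda>i. (i, i + d)) ` P d)"
  proof -
    have "(i, j) \<in> (\<lambda>i. (i, i + (j - i))) ` P (j - i)" if "i \<in> S" "j \<in> T" for i j
      using that by (auto simp: P_def)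
    then show ?thesis
      by (fastforce simp: P_def)
  qed
  also have "card \<dots> = (\<Sum>d\<in>UNIV. card ((\<lambda>i. (i, i + d)) ` P d))"
    by (rule card_UN_disjoint) auto
  also have "\<dots> = (\<Sum>d\<in>UNIV. card (P d))"
    by (intro sum.cong refl card_image) (simp add: inj_on_def)
  also have "\<dots> = 3 * card (P a)"
    unfolding UNIV using dist empty card by simp
  finally have prod: "card S * card T = 3 * card (P a)" .
  have shift: "card ((+) d ` S) = card S" for d
    by (rule card_image) (simp add: inj_on_def)
  have disj: "(+) e ` S \<inter> T = {}" "(+) f ` S \<inter> T = {}"
    using empty by (auto simp: P_def add.commute)
  have bound: "card S + card T \<le> 5"
    using card_Un_disjoint[OF fin fin disj(1)] shift[of e] card_mono[OF fin, of "(+) e ` S \<union> T" UNIV]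
    by simp
  have "card S + card T \<noteq> 5"
  proof
    \<comment> \<open>Both translates would be the complement of T, so S would be invariant under
      adding \<open>e - f\<close>, a nonzero element and hence a generator of Z/5. Then S is
      everything and T is empty.\<close>
    assume eq: "card S + card T = 5"
    have compl: "(+) d ` S = - T" if "(+) d ` S \<inter> T = {}" for d
      using that eq shift[of d] by (intro card_subset_eq) (auto simp: Compl_eq_Diff_UNIV card_Diff_subset)
    have efS: "(+) e ` S = (+) f ` S"
      using compl[OF disj(1)] compl[OF disj(2)] by simp
    have step: "i + (e - f) \<in> S" if "i \<in> S" for i
    proof -
      have "e + i \<in> (+) f ` S"
        using that efS by blast
      then obtain i' where "i' \<in> S" "e + i = f + i'"
        by blast
      moreover from this have "i' = i + (e - f)"
        by (simp add: algebra_simps)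
      ultimately show ?thesis
        by simp
    qed
    obtain i where i: "i \<in> S"
      using \<open>S \<noteq> {}\<close> by blast
    define w where "w = e - f"
    have "w \<in> {0, 1, 2, 3, 4}"
      using UNIV_5 by blast
    then have "w \<in> {1, 2, 3, 4}"
      using dist by (auto simp: w_def)
    then have range: "{i, i + w, i + 2 * w, i + 3 * w, i + 4 * w} = (+) i ` UNIV"
      unfolding UNIV_5 by auto
    have "{i, i + w, i + w + w, i + w + w + w, i + w + w + w + w} \<subseteq> S"
      using step i unfolding w_def by blast
    also have "{i, i + w, i + w + w, i + w + w + w, i + w + w + w + w} =
        {i, i + w, i + 2 * w, i + 3 * w, i + 4 * w}"
      by (simp add: add.assoc)
    finally have "S = UNIV"
      unfolding range by auto
    then have "card S = 5"
      by simp
    with eq \<open>T \<noteq> {}\<close> show False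
      by (simp add: card_eq_0_iff)
  qed
  with bound have bound: "card S + card T \<le> 4"
    by simp
  have pos: "card S > 0" "card T > 0"
    using assms by (simp_all add: card_gt_0_iff)
  have "prime (3::nat)"
    by simp
  moreover have "3 dvd card S * card T"
    using prod by simp
  ultimately have "3 dvd card S \<or> 3 dvd card T"
    using prime_dvd_mult_eq_nat by blast
  then show ?thesis
    using bound pos by (auto dest!: dvd_imp_le)
qed

section \<open>Linear combinations of five automorphisms indexed by Z/5\<close>

text \<open>This models the powers of a generator of a cyclic Galois group of order 5. The index
  type \<open>5\<close> reduces exponents modulo 5 by itself, and \<open>phi_indep\<close> is
  Dedekind's independence of distinct automorphisms.\<close>

locale cyclic5_automorphisms =
  fixes \<phi> :: "5 \<Rightarrow> 'a::field \<Rightarrow> 'a"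
  assumes phi_0: "\<phi> 0 x = x"
    and phi_add: "\<phi> (i + j) x = \<phi> i (\<phi> j x)"
    and phi_plus: "\<phi> i (x + y) = \<phi> i x + \<phi> i y"
    and phi_mult: "\<phi> i (x * y) = \<phi> i x * \<phi> i y"
    and phi_indep: "(\<And>x. (\<Sum>i\<in>UNIV. c i * \<phi> i x) = 0) \<Longrightarrow> c j = 0"
begin

lemma phi_phi: "\<phi> i (\<phi> j x) = \<phi> (i + j) x"
  by (simp add: phi_add)

lemma phi_of_0 [simp]: "\<phi> i 0 = 0"
  using phi_plus[of i 0 0] by (metis add.right_neutral add_left_cancel)

lemma phi_uminus: "\<phi> i (- x) = - \<phi> i x"
  using phi_plus[of i x "- x"] by (simp add: eq_neg_iff_add_eq_0 add.commute)

lemma phi_inject: "\<phi> i x = \<phi> i y \<longleftrightarrow> x = y"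
proof
  assume "\<phi> i x = \<phi> i y"
  then have "\<phi> (- i) (\<phi> i x) = \<phi> (- i) (\<phi> i y)"
    by simp
  then show "x = y"
    by (simp add: phi_phi phi_0)
qed simp

lemma phi_eq_0 [simp]: "\<phi> i x = 0 \<longleftrightarrow> x = 0"
  using phi_inject[of i x 0] by simp

lemma phi_sum: "\<phi> i (sum f A) = (\<Sum>x\<in>A. \<phi> i (f x))"
  by (induction A rule: infinite_finite_induct) (simp_all add: phi_plus)

lemma sum_shift5: "(\<Sum>i\<in>UNIV. f (i + d :: 5)) = (\<Sum>i\<in>UNIV. f i)"
  by (rule sum.reindex_bij_witness[of _ "\<lambda>i. i - d" "\<lambda>i. i + d"]) auto

lemma coeff_eq:
  assumes "\<And>x. (\<Sum>i\<in>UNIV. a i * \<phi> i x) = (\<Sum>i\<in>UNIV. b i * \<phi> i x)"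
  shows "a j = b j"
  using phi_indep[of "\<lambda>i. a i - b i" j] assms by (simp add: algebra_simps sum_subtractf)

text \<open>In a code the last coefficient is \<open>\<theta>\<close> times a Frobenius image of the
  first. Applying \<open>\<phi> u\<close> to a combination moves index \<open>i\<close> to
  \<open>i + u\<close>, hence the shift by \<open>u\<close> in the comparison of
  coefficients.\<close>

lemma coeff_eq_twist:
  assumes "\<And>x. (\<Sum>i\<in>UNIV. a i * \<phi> i x) = \<theta> * \<phi> u (\<Sum>i\<in>UNIV. b i * \<phi> i x)"
  shows "a j = \<theta> * \<phi> u (b (j - u))"
proof (rule coeff_eq[where b = "\<lambda>j. \<theta> * \<phi> u (b (j - u))"])
  fix x
  have "\<theta> * \<phi> u (\<Sum>i\<in>UNIV. b i * \<phi> i x) = (\<Sum>i\<in>UNIV. \<theta> * \<phi> u (b (i + u - u)) * \<phi> (i + u) x)"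
    by (simp add: phi_sum phi_mult phi_phi sum_distrib_left mult.assoc add.commute)
  also have "\<dots> = (\<Sum>i\<in>UNIV. \<theta> * \<phi> u (b (i - u)) * \<phi> i x)"
    by (rule sum_shift5[of "\<lambda>i. \<theta> * \<phi> u (b (i - u)) * \<phi> i x"])
  finally show "(\<Sum>i\<in>UNIV. a i * \<phi> i x) = (\<Sum>i\<in>UNIV. \<theta> * \<phi> u (b (i - u)) * \<phi> i x)"
    using assms by simp
qed

definition qmap :: "(5 \<Rightarrow> 'a) \<Rightarrow> 'a \<Rightarrow> 'a" where
  "qmap a x = (\<Sum>i\<in>UNIV. a i * \<phi> i x)"

text \<open>With \<open>L\<^sub>1 = qmap l\<close> and \<open>L\<^sub>2 = qmap m\<close>, \<open>sandwich l m b r\<close> is the coefficient of \<open>\<phi> r\<close> in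
  \<open>L\<^sub>1 \<circ> qmap b \<circ> L\<^sub>2\<close>, and \<open>kernel l m d r i\<close> is the factor of \<open>\<phi> i (b d)\<close> in it.\<close>

definition kernel :: "(5 \<Rightarrow> 'a) \<Rightarrow> (5 \<Rightarrow> 'a) \<Rightarrow> 5 \<Rightarrow> 5 \<Rightarrow> 5 \<Rightarrow> 'a" where
  "kernel l m d r i = l i * \<phi> (i + d) (m (r - i - d))"

definition sandwich :: "(5 \<Rightarrow> 'a) \<Rightarrow> (5 \<Rightarrow> 'a) \<Rightarrow> (5 \<Rightarrow> 'a) \<Rightarrow> 5 \<Rightarrow> 'a" where
  "sandwich l m b r = (\<Sum>d\<in>UNIV. \<Sum>i\<in>UNIV. kernel l m d r i * \<phi> i (b d))"

lemma qmap_sandwich: "qmap l (qmap b (qmap m x)) = qmap (sandwich l m b) x"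
proof -
  have "qmap l (qmap b (qmap m x)) =
      (\<Sum>i\<in>UNIV. \<Sum>d\<in>UNIV. \<Sum>j\<in>UNIV. l i * \<phi> i (b d) * \<phi> (i + d) (m j) * \<phi> (i + d + j) x)"
    by (simp add: qmap_def phi_sum phi_mult phi_phi sum_distrib_left mult.assoc add.assoc)
  also have "\<dots> = (\<Sum>i\<in>UNIV. \<Sum>d\<in>UNIV. \<Sum>r\<in>UNIV.
      l i * \<phi> i (b d) * \<phi> (i + d) (m (r - i - d)) * \<phi> r x)"
  proof -
    have "(\<Sum>j\<in>UNIV. l i * \<phi> i (b d) * \<phi> (i + d) (m j) * \<phi> (i + d + j) x) =
        (\<Sum>r\<in>UNIV. l i * \<phi> i (b d) * \<phi> (i + d) (m (r - i - d)) * \<phi> r x)" for i d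
      by (rule sum.reindex_bij_witness[of _ "\<lambda>r. r - i - d" "\<lambda>j. i + d + j"]) (auto simp: algebra_simps)
    then show ?thesis
      by simp
  qed
  also have "\<dots> = (\<Sum>d\<in>UNIV. \<Sum>i\<in>UNIV. \<Sum>r\<in>UNIV.
      l i * \<phi> i (b d) * \<phi> (i + d) (m (r - i - d)) * \<phi> r x)"
    by (rule sum.swap)
  also have "\<dots> = (\<Sum>d\<in>UNIV. \<Sum>r\<in>UNIV. \<Sum>i\<in>UNIV.
      l i * \<phi> i (b d) * \<phi> (i + d) (m (r - i - d)) * \<phi> r x)"
    by (rule sum.cong[OF refl], rule sum.swap)
  also have "\<dots> = (\<Sum>r\<in>UNIV. \<Sum>d\<in>UNIV. \<Sum>i\<in>UNIV.
      l i * \<phi> i (b d) * \<phi> (i + d) (m (r - i - d)) * \<phi> r x)"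
    by (rule sum.swap)
  also have "\<dots> = qmap (sandwich l m b) x"
    by (simp add: qmap_def sandwich_def kernel_def sum_distrib_left sum_distrib_right mult_ac)
  finally show ?thesis .
qed

lemma qmap_inject:
  assumes "\<And>x. qmap a x = qmap b x"
  shows "a = b"
  using coeff_eq[of a b] assms by (auto simp: qmap_def)

text \<open>A test word with one free coefficient \<open>x\<close> turns each coefficient of the
  composite into a combination of the \<open>\<phi> i x\<close>, to which linear independence
  applies.\<close>

lemma sandwich_single:
  "sandwich l m (\<lambda>e. if e = d then x else 0) r = (\<Sum>i\<in>UNIV. kernel l m d r i * \<phi> i x)"
proof -
  have "sandwich l m (\<lambda>e. if e = d then x else 0) r =
      (\<Sum>e\<in>UNIV. if e = d then \<Sum>i\<in>UNIV. kernel l m e r i * \<phi> i x else 0)"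
    unfolding sandwich_def by (intro sum.cong) auto
  then show ?thesis
    by simp
qed

text \<open>The free coefficient at 0 drags along its twist at \<open>p\<close>. Since
  \<open>\<phi> i\<close> after \<open>\<phi> v\<close> is \<open>\<phi> (i + v)\<close>, the second
  contribution to \<open>\<phi> i x\<close> comes from index \<open>i - v\<close>.\<close>

lemma sandwich_pair:
  assumes "p \<noteq> 0"
  shows "sandwich l m (\<lambda>e. if e = 0 then x else if e = p then \<eta> * \<phi> v x else 0) r =
    (\<Sum>i\<in>UNIV. (kernel l m 0 r i + kernel l m p r (i - v) * \<phi> (i - v) \<eta>) * \<phi> i x)"
proof -
  have "sandwich l m (\<lambda>e. if e = 0 then x else if e = p then \<eta> * \<phi> v x else 0) r =
      (\<Sum>e\<in>UNIV. (if e = 0 then \<Sum>i\<in>UNIV. kernel l m 0 r i * \<phi> i x else 0) +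
        (if e = p then \<Sum>i\<in>UNIV. kernel l m p r i * \<phi> i (\<eta> * \<phi> v x) else 0))"
    unfolding sandwich_def using assms by (intro sum.cong) auto
  also have "\<dots> = (\<Sum>i\<in>UNIV. kernel l m 0 r i * \<phi> i x) +
      (\<Sum>i\<in>UNIV. kernel l m p (r) (i + v - v) * \<phi> (i + v - v) \<eta> * \<phi> (i + v) x)"
    by (simp add: sum.distrib phi_mult phi_phi mult.assoc)
  also have "(\<Sum>i\<in>UNIV. kernel l m p r (i + v - v) * \<phi> (i + v - v) \<eta> * \<phi> (i + v) x) =
      (\<Sum>i\<in>UNIV. kernel l m p r (i - v) * \<phi> (i - v) \<eta> * \<phi> i x)"
    by (rule sum_shift5[of "\<lambda>i. kernel l m p r (i - v) * \<phi> (i - v) \<eta> * \<phi> i x"])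
  finally show ?thesis
    by (simp add: sum.distrib algebra_simps)
qed

section \<open>Norms and the equations left by a monomial factor\<close>

lemma prod_phi: "(\<Prod>i\<in>UNIV. \<phi> i x) = x * \<phi> 1 x * \<phi> 2 x * \<phi> 3 x * \<phi> 4 x"
  unfolding UNIV_5 by (simp add: phi_0 mult_ac)

lemma prod_phi_phi: "(\<Prod>i\<in>UNIV. \<phi> i (\<phi> j x)) = (\<Prod>i\<in>UNIV. \<phi> i x)"
  by (simp add: phi_phi)
    (rule prod.reindex_bij_witness[of _ "\<lambda>i. i - j" "\<lambda>i. i + j"]; simp)

text \<open>Nonvanishing depends on \<open>d\<close> and \<open>r\<close> only through
  \<open>d - r\<close>. This is why a single index suffices for the sets \<open>P\<close>
  below.\<close>

lemma kernel_eq_0_iff: "kernel l m d r i = 0 \<longleftrightarrow> \<not> (l i \<noteq> 0 \<and> m (- (i + (d - r))) \<noteq> 0)"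
  by (simp add: kernel_def algebra_simps)

lemma cancel_common_factor:
  fixes a b c h :: 'a
  assumes "a * c + b * c * h = 0" "c \<noteq> 0"
  shows "a = - (b * h)"
proof -
  have "(a + b * h) * c = 0"
    using assms(1) by (simp add: algebra_simps)
  then show ?thesis
    using assms(2) by (simp add: eq_neg_iff_add_eq_0)
qed

lemma eq_minus_1_of_eq_neg_mult:
  fixes a n :: 'a
  assumes "a = - (n * a)" "a \<noteq> 0"
  shows "n = - 1"
proof -
  have "(n + 1) * a = 0"
    using assms(1) by (simp add: distrib_right eq_neg_iff_add_eq_0 add.commute)
  then show ?thesis
    using assms(2) by (simp add: eq_neg_iff_add_eq_0)
qed

text \<open>In the next four lemmas the hypotheses are the coefficient equations that remain when \<open>L\<^sub>1\<close>
  (left) or \<open>L\<^sub>2\<close> (right) is a monomial; the first two belong to \<open>k = 2\<close>, the others to \<open>k = 3\<close>.\<close>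

lemma norm_1_of_left_twist:
  assumes "\<phi> 1 m3 = \<theta> * \<phi> 1 m4" "m1 = - (h * \<phi> 2 m4)" "m3 = - (h * \<phi> 2 m1)"
    "m4 = \<theta> * h * \<phi> 2 m3" "m4 \<noteq> 0"
  shows "(\<Prod>i\<in>UNIV. \<phi> i h) = 1"
proof -
  have m3: "m3 = h * \<phi> 2 h * \<phi> 4 m4"
    using assms(2,3) by (simp add: phi_uminus phi_mult phi_phi numerals_5)
  \<comment> \<open>The extra factor \<open>\<phi> 1 m4\<close> lets the first hypothesis eliminate
    \<open>\<theta>\<close>.\<close>
  have "m4 * \<phi> 1 m4 = (\<theta> * \<phi> 1 m4) * h * \<phi> 2 m3"
    by (subst assms(4)) (simp add: mult_ac)
  also have "\<dots> = \<phi> 1 m3 * h * \<phi> 2 m3"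
    by (simp only: assms(1))
  also have "\<dots> = (\<Prod>i\<in>UNIV. \<phi> i h) * (m4 * \<phi> 1 m4)"
    by (simp add: m3 phi_mult phi_phi numerals_5 phi_0 prod_phi mult_ac)
  finally show ?thesis
    using assms(5) by simp
qed

lemma norm_1_of_right_twist:
  assumes "l3 = \<theta> * \<phi> 4 a" "l1 = - (a * \<phi> 4 h)" "l3 = - (l1 * \<phi> 1 h)"
    "a = \<theta> * \<phi> 4 l3 * \<phi> 2 h" "a \<noteq> 0"
  shows "(\<Prod>i\<in>UNIV. \<phi> i h) = 1"
proof -
  have l3: "l3 = a * \<phi> 4 h * \<phi> 1 h"
    using assms(2,3) by simp
  \<comment> \<open>Here \<open>\<phi> 4 a\<close> is the factor that eliminates
    \<open>\<theta>\<close>.\<close>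
  have "a * \<phi> 4 a = (\<theta> * \<phi> 4 a) * \<phi> 4 l3 * \<phi> 2 h"
    by (subst assms(4)) (simp add: mult_ac)
  also have "\<dots> = l3 * \<phi> 4 l3 * \<phi> 2 h"
    by (simp only: assms(1))
  also have "\<dots> = (\<Prod>i\<in>UNIV. \<phi> i h) * (a * \<phi> 4 a)"
    by (simp add: l3 phi_mult phi_phi numerals_5 phi_0 prod_phi mult_ac)
  finally show ?thesis
    using assms(5) by simp
qed

lemma norm_minus_1_of_left_twist:
  assumes "\<phi> 1 m0 = \<theta> * \<phi> 1 m4" "\<phi> 2 m4 = \<theta> * \<phi> 2 m3" "m3 = - (h * \<phi> 3 m0)"
    "h * \<phi> 3 m3 = \<theta> * m0" "m0 \<noteq> 0"
  shows "(\<Prod>i\<in>UNIV. \<phi> i h) = - 1"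
proof -
  have th: "\<theta> * m0 = - (h * \<phi> 3 h * \<phi> 1 m0)"
    by (subst assms(4)[symmetric]) (simp add: assms(3) phi_mult phi_phi numerals_5 phi_uminus mult_ac)
  have m0: "m0 = \<phi> 4 \<theta> * m4"
    using arg_cong[OF assms(1), of "\<phi> 4"] by (simp add: phi_mult phi_phi numerals_5 phi_0)
  have m4: "m4 = \<phi> 3 \<theta> * m3"
    using arg_cong[OF assms(2), of "\<phi> 3"] by (simp add: phi_mult phi_phi numerals_5 phi_0)
  have th4: "\<phi> 4 \<theta> * \<phi> 4 m0 = - (\<phi> 4 h * \<phi> 2 h * m0)"
    using arg_cong[OF th, of "\<phi> 4"] by (simp add: phi_mult phi_phi numerals_5 phi_0 phi_uminus)
  have th3: "\<phi> 3 \<theta> * \<phi> 3 m0 = - (\<phi> 3 h * \<phi> 1 h * \<phi> 4 m0)"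
    using arg_cong[OF th, of "\<phi> 3"] by (simp add: phi_mult phi_phi numerals_5 phi_0 phi_uminus)
  \<comment> \<open>Unfolding \<open>m0\<close> and \<open>m4\<close> produces two conjugates of
    \<open>\<theta>\<close>; the extra factors pair each of them with the same conjugate of
    \<open>m0\<close>, and these products are known.\<close>
  have "m0 * (\<phi> 4 m0 * \<phi> 3 m0) = (\<phi> 4 \<theta> * \<phi> 4 m0) * (\<phi> 3 \<theta> * \<phi> 3 m0) * m3"
    by (subst m0, subst m4) (simp add: mult_ac)
  also have "\<dots> = - ((\<Prod>i\<in>UNIV. \<phi> i h) * (m0 * (\<phi> 4 m0 * \<phi> 3 m0)))"
    unfolding th4 th3 by (simp add: assms(3) prod_phi mult_ac)
  finally show ?thesis
    by (rule eq_minus_1_of_eq_neg_mult) (use assms(5) in simp)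
qed

lemma norm_minus_1_of_right_twist:
  assumes "a0 = \<theta> * \<phi> 1 a1" "a1 = \<theta> * \<phi> 1 a2" "a2 = - (a0 * h)"
    "a2 * \<phi> 3 h = \<theta> * \<phi> 1 a0" "a0 \<noteq> 0"
  shows "(\<Prod>i\<in>UNIV. \<phi> i h) = - 1"
proof -
  \<comment> \<open>In what follows \<open>\<theta>\<close> occurs only in this product, so
    expressing it by \<open>a0\<close> and \<open>h\<close> eliminates
    \<open>\<theta>\<close>.\<close>
  have th: "\<theta> * \<phi> 1 a0 = - (a0 * h * \<phi> 3 h)"
    using assms(3,4) by simp
  have "a1 = - (\<theta> * \<phi> 1 a0) * \<phi> 1 h"
    by (subst assms(2)) (simp add: assms(3) phi_mult phi_uminus mult_ac)
  then have a1: "a1 = a0 * h * \<phi> 3 h * \<phi> 1 h"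
    unfolding th by simp
  have "a0 = (\<theta> * \<phi> 1 a0) * (\<phi> 1 h * \<phi> 4 h * \<phi> 2 h)"
    by (subst assms(1)) (simp add: a1 phi_mult phi_phi numerals_5 mult_ac)
  also have "\<dots> = - ((\<Prod>i\<in>UNIV. \<phi> i h) * a0)"
    unfolding th by (simp add: prod_phi mult_ac)
  finally show ?thesis
    by (rule eq_minus_1_of_eq_neg_mult) (use assms(5) in simp)
qed

section \<open>From coefficient equations to the norm, for k = 2 and k = 3\<close>

text \<open>The source indices are 0, 1, 2 and the target indices 0, 2, 4, with 4 the twisted one.
  Testing with the coefficient at 1 alone shows \<open>P 0\<close> and \<open>P 3\<close> empty; the
  other equations make \<open>P 1\<close>, \<open>P 2\<close>, \<open>P 4\<close> translates of each
  other.\<close>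

lemma norm_of_sandwich_k2:
  fixes u v :: 5
  assumes l: "l i0 \<noteq> 0" and m: "m j0 \<noteq> 0" and eta: "\<eta> \<noteq> 0" and theta: "\<theta> \<noteq> 0"
    and code: "\<And>b. \<lbrakk>b 2 = \<eta> * \<phi> v (b 0); b 3 = 0; b 4 = 0\<rbrakk> \<Longrightarrow>
      sandwich l m b 1 = 0 \<and> sandwich l m b 3 = 0 \<and>
      sandwich l m b 4 = \<theta> * \<phi> u (sandwich l m b 0)"
  shows "(\<Prod>i\<in>UNIV. \<phi> i \<eta>) = 1"
proof -
  let ?K = "kernel l m"
  have single: "sandwich l m (\<lambda>e. if e = 1 then x else 0) 1 = 0"
    "sandwich l m (\<lambda>e. if e = 1 then x else 0) 3 = 0"
    "sandwich l m (\<lambda>e. if e = 1 then x else 0) 4 =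
      \<theta> * \<phi> u (sandwich l m (\<lambda>e. if e = 1 then x else 0) 0)" for x
    using code[of "\<lambda>e. if e = 1 then x else 0"] by auto
  have pair: "sandwich l m (\<lambda>e. if e = 0 then x else if e = 2 then \<eta> * \<phi> v x else 0) 1 = 0"
    "sandwich l m (\<lambda>e. if e = 0 then x else if e = 2 then \<eta> * \<phi> v x else 0) 3 = 0"
    "sandwich l m (\<lambda>e. if e = 0 then x else if e = 2 then \<eta> * \<phi> v x else 0) 4 =
      \<theta> * \<phi> u (sandwich l m (\<lambda>e. if e = 0 then x else if e = 2 then \<eta> * \<phi> v x else 0) 0)" for x
    using code[of "\<lambda>e. if e = 0 then x else if e = 2 then \<eta> * \<phi> v x else 0"] by auto
  have K11: "?K 1 1 i = 0" for i
    using single(1) unfolding sandwich_single by (rule phi_indep)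
  have K13: "?K 1 3 i = 0" for i
    using single(2) unfolding sandwich_single by (rule phi_indep)
  have K14: "?K 1 4 i = \<theta> * \<phi> u (?K 1 0 (i - u))" for i
    using single(3) unfolding sandwich_single by (rule coeff_eq_twist)
  have two: "(2::5) \<noteq> 0"
    by simp
  have K01: "?K 0 1 i + ?K 2 1 (i - v) * \<phi> (i - v) \<eta> = 0" for i
    using pair(1) unfolding sandwich_pair[OF two] by (rule phi_indep)
  have K03: "?K 0 3 i + ?K 2 3 (i - v) * \<phi> (i - v) \<eta> = 0" for i
    using pair(2) unfolding sandwich_pair[OF two] by (rule phi_indep)
  have K04: "?K 0 4 i + ?K 2 4 (i - v) * \<phi> (i - v) \<eta> =
      \<theta> * \<phi> u (?K 0 0 (i - u) + ?K 2 0 (i - u - v) * \<phi> (i - u - v) \<eta>)" for i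
    using pair(3) unfolding sandwich_pair[OF two]
    by (rule coeff_eq_twist[where b = "\<lambda>i. ?K 0 0 i + ?K 2 0 (i - v) * \<phi> (i - v) \<eta>"])
  define S where "S = {i. l i \<noteq> 0}"
  define T where "T = {i. m (- i) \<noteq> 0}"
  define P where "P = (\<lambda>d. {i \<in> S. i + d \<in> T})"
  have P: "?K d r i \<noteq> 0 \<longleftrightarrow> i \<in> P e" if "e = d - r" for d r e i
    unfolding that by (simp add: kernel_eq_0_iff P_def S_def T_def del: minus_add_distrib)
  have PK: "?K 1 1 i \<noteq> 0 \<longleftrightarrow> i \<in> P 0" "?K 0 0 i \<noteq> 0 \<longleftrightarrow> i \<in> P 0"
    "?K 1 0 i \<noteq> 0 \<longleftrightarrow> i \<in> P 1" "?K 0 4 i \<noteq> 0 \<longleftrightarrow> i \<in> P 1" "?K 2 1 i \<noteq> 0 \<longleftrightarrow> i \<in> P 1"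
    "?K 1 4 i \<noteq> 0 \<longleftrightarrow> i \<in> P 2" "?K 0 3 i \<noteq> 0 \<longleftrightarrow> i \<in> P 2"
    "?K 1 3 i \<noteq> 0 \<longleftrightarrow> i \<in> P 3" "?K 2 4 i \<noteq> 0 \<longleftrightarrow> i \<in> P 3"
    "?K 0 1 i \<noteq> 0 \<longleftrightarrow> i \<in> P 4" "?K 2 3 i \<noteq> 0 \<longleftrightarrow> i \<in> P 4" for i
    by (rule P, simp)+
  have P0: "P 0 = {}" and P3: "P 3 = {}"
    using K11 K13 PK by blast+
  \<comment> \<open>The two discarded terms have differences \<open>0 - 0 = 0\<close> and
    \<open>2 - 4 = 3\<close>, where \<open>P\<close> is empty.\<close>
  have K04: "?K 0 4 i = \<theta> * \<phi> u (?K 2 0 (i - u - v) * \<phi> (i - u - v) \<eta>)" for i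
    using K04[of i] PK(2)[of "i - u"] PK(9)[of "i - v"] P0 P3 by simp
  have P21: "i \<in> P 2 \<longleftrightarrow> i - u \<in> P 1" for i
    using K14[of i] theta by (subst PK(6)[symmetric], subst PK(3)[symmetric]) simp
  have P41: "i \<in> P 4 \<longleftrightarrow> i - v \<in> P 1" for i
    using K01[of i] eta by (subst PK(10)[symmetric], subst PK(5)[symmetric]) auto
  have shift: "card X = card Y" if "\<And>i. i \<in> X \<longleftrightarrow> i - w \<in> Y" for X Y :: "5 set" and w
    by (rule bij_betw_same_card[of "\<lambda>i. i - w"], rule bij_betwI[of _ _ _ "\<lambda>i. i + w"])
      (use that in auto)
  have ST: "S \<noteq> {}" "T \<noteq> {}"
    using l m by (auto simp: S_def T_def intro: exI[of _ "- j0"])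
  \<comment> \<open>Every pair from S and T has some difference, and translates are empty
    together.\<close>
  have nonempty: "P 1 \<noteq> {} \<and> P 2 \<noteq> {} \<and> P 4 \<noteq> {}"
  proof -
    obtain i j where "i \<in> S" "j \<in> T"
      using ST by blast
    then have "i \<in> P (j - i)"
      by (simp add: P_def)
    moreover have "j - i \<in> {0, 1, 2, 3, 4}"
      using UNIV_5 by blast
    ultimately have "P 1 \<noteq> {} \<or> P 2 \<noteq> {} \<or> P 4 \<noteq> {}"
      using P0 P3 by auto
    moreover have "P 1 \<noteq> {} \<longleftrightarrow> P 2 \<noteq> {}" "P 1 \<noteq> {} \<longleftrightarrow> P 4 \<noteq> {}"
      using shift[OF P21] shift[OF P41] by (metis card_eq_0_iff finite_code)+
    ultimately show ?thesis
      by blast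
  qed
  have "card S = 1 \<or> card T = 1"
  proof -
    have "UNIV = {1, 2, 4, 0, 3 :: 5}"
      using UNIV_5 by auto
    then show ?thesis
      using card_eq_1_of_three_differences[of 1 2 4 0 3 S T] P0 P3 ST shift[OF P21] shift[OF P41]
      by (simp add: P_def)
  qed
  then show ?thesis
  proof
    assume "card S = 1"
    then obtain i where S: "S = {i}"
      by (auto simp: card_1_singleton_iff)
    then have "P d \<subseteq> {i}" for d
      by (auto simp: P_def)
    with nonempty have Pi: "P 1 = {i}" "P 2 = {i}" "P 4 = {i}"
      by blast+
    \<comment> \<open>All three sets are the same singleton, so the translations between them are
      trivial.\<close>
    have u: "u = 0" and v: "v = 0"
      using P21[of i] P41[of i] Pi by auto
    \<comment> \<open>These are the coefficients of \<open>\<phi> i\<close> composed with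
      \<open>qmap m\<close>; the factor \<open>l i\<close> cancels from all equations.\<close>
    define M where "M = (\<lambda>d. \<phi> i (m (d - i)))"
    have K: "?K d r i = l i * \<phi> d (M (r - d))" for d r
      by (simp add: kernel_def M_def phi_phi algebra_simps)
    have li: "l i \<noteq> 0"
      using S by (auto simp: S_def)
    \<comment> \<open>The equations involve the conjugate \<open>\<phi> i \<eta>\<close>, which has
      the same norm as \<open>\<eta>\<close>.\<close>
    have "(\<Prod>j\<in>UNIV. \<phi> j (\<phi> i \<eta>)) = 1"
    proof (rule norm_1_of_left_twist)
      show "\<phi> 1 (M 3) = \<theta> * \<phi> 1 (M 4)"
        using K14[of i] li by (simp add: u K phi_0 numerals_5)
      show "M 1 = - (\<phi> i \<eta> * \<phi> 2 (M 4))"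
        using cancel_common_factor[of "M 1" "l i" "\<phi> 2 (M 4)" "\<phi> i \<eta>"] K01[of i] li
        by (simp add: v K phi_0 numerals_5 mult_ac)
      show "M 3 = - (\<phi> i \<eta> * \<phi> 2 (M 1))"
        using cancel_common_factor[of "M 3" "l i" "\<phi> 2 (M 1)" "\<phi> i \<eta>"] K03[of i] li
        by (simp add: v K phi_0 numerals_5 mult_ac)
      show "M 4 = \<theta> * \<phi> i \<eta> * \<phi> 2 (M 3)"
        using K04[of i] li by (simp add: u v K phi_0 numerals_5 mult_ac)
      show "M 4 \<noteq> 0"
        using PK(4)[of i] Pi li by (simp add: K)
    qed
    then show ?thesis
      by (simp add: prod_phi_phi)
  next
    assume "card T = 1"
    then obtain j where T: "T = {j}"
      by (auto simp: card_1_singleton_iff)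
    then have "P d \<subseteq> {j - d}" for d
      by (auto simp: P_def)
    with nonempty have Pj: "P 1 = {j - 1}" "P 2 = {j - 2}" "P 4 = {j - 4}"
      by blast+
    \<comment> \<open>Now the three sets are distinct singletons, and the translations between them
      determine \<open>u\<close> and \<open>v\<close>.\<close>
    have "j - 2 - u = j - 1" "j - 4 - v = j - 1"
      using P21[of "j - 2"] P41[of "j - 4"] Pj by auto
    then have "u + 1 = 0" "v + 3 = 0"
      by (simp_all add: algebra_simps)
    then have u: "u = 4" and v: "v = 2"
      unfolding eq_neg_iff_add_eq_0[symmetric] by simp_all
    \<comment> \<open>The only nonzero coefficient of \<open>qmap m\<close> stands at
      \<open>- j\<close>, so a kernel can be nonzero only for \<open>i + d = j + r\<close>. Its
      second factor is then \<open>\<phi> r X\<close>, the same on both sides of an equation within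
      one \<open>r\<close>.\<close>
    define X where "X = \<phi> j (m (- j))"
    have X: "X \<noteq> 0"
      using T by (auto simp: X_def T_def)
    have K: "?K d r i = l i * \<phi> r X" if "i + d = j + r" for d r i
    proof -
      have "r - i - d = - j" "i + d = r + j"
        using that by (simp_all add: algebra_simps)
      then show ?thesis
        by (simp add: kernel_def X_def phi_phi)
    qed
    have idx: "j - 2 - 4 = j - 1" "j - 4 - 2 = j - 1" "j - 2 - 2 = j - 4" "j - 1 - 4 - 2 = j - 2"
      by (simp_all add: algebra_simps)
    have eta: "\<phi> (j - 1) \<eta> = \<phi> 4 (\<phi> j \<eta>)" "\<phi> (j - 4) \<eta> = \<phi> 1 (\<phi> j \<eta>)"
      "\<phi> (j - 2) \<eta> = \<phi> 3 (\<phi> j \<eta>)"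
      unfolding phi_phi by (rule arg_cong[of _ _ "\<lambda>i. \<phi> i \<eta>"], simp add: algebra_simps)+
    have "(\<Prod>i\<in>UNIV. \<phi> i (\<phi> j \<eta>)) = 1"
    proof (rule norm_1_of_right_twist)
      have "?K 1 4 (j - 2) = l (j - 2) * \<phi> 4 X" "?K 1 0 (j - 1) = l (j - 1) * \<phi> 0 X"
        by (rule K; simp add: algebra_simps)+
      then show "l (j - 2) = \<theta> * \<phi> 4 (l (j - 1))"
        using K14[of "j - 2"] X by (simp add: u idx phi_mult phi_phi)
      have "?K 0 1 (j - 4) = l (j - 4) * \<phi> 1 X" "?K 2 1 (j - 1) = l (j - 1) * \<phi> 1 X"
        by (rule K; simp add: algebra_simps)+
      then show "l (j - 4) = - (l (j - 1) * \<phi> 4 (\<phi> j \<eta>))"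
        using K01[of "j - 4"] X by (intro cancel_common_factor[of _ "\<phi> 1 X"]) (simp_all add: v idx eta)
      have "?K 0 3 (j - 2) = l (j - 2) * \<phi> 3 X" "?K 2 3 (j - 4) = l (j - 4) * \<phi> 3 X"
        by (rule K; simp add: algebra_simps)+
      then show "l (j - 2) = - (l (j - 4) * \<phi> 1 (\<phi> j \<eta>))"
        using K03[of "j - 2"] X by (intro cancel_common_factor[of _ "\<phi> 3 X"]) (simp_all add: v idx eta)
      have "?K 0 4 (j - 1) = l (j - 1) * \<phi> 4 X" "?K 2 0 (j - 2) = l (j - 2) * \<phi> 0 X"
        by (rule K; simp add: algebra_simps)+
      then show "l (j - 1) = \<theta> * \<phi> 4 (l (j - 2)) * \<phi> 2 (\<phi> j \<eta>)"
        using K04[of "j - 1"] X unfolding u v idx eta by (simp add: phi_mult phi_phi numerals_5 mult.assoc)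
      show "l (j - 1) \<noteq> 0"
        using Pj by (auto simp: P_def S_def)
    qed
    then show ?thesis
      by (simp add: prod_phi_phi)
  qed
qed
text \<open>The source indices are 0, 1, 2, 3 and the target indices 0, 2, 4, 1, since 6 is 1 modulo
  5: index 3 is missing and the twisted coefficient stands at 1. Here \<open>P 3\<close> and
  \<open>P 4\<close> are empty and \<open>P 0\<close>, \<open>P 1\<close>, \<open>P 2\<close> are
  translates of each other.\<close>

lemma norm_of_sandwich_k3:
  fixes u v :: 5
  assumes l: "l i0 \<noteq> 0" and m: "m j0 \<noteq> 0" and eta: "\<eta> \<noteq> 0" and theta: "\<theta> \<noteq> 0"
    and code: "\<And>b. \<lbrakk>b 3 = \<eta> * \<phi> v (b 0); b 4 = 0\<rbrakk> \<Longrightarrow>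
      sandwich l m b 3 = 0 \<and>
      sandwich l m b 1 = \<theta> * \<phi> u (sandwich l m b 0)"
  shows "(\<Prod>i\<in>UNIV. \<phi> i \<eta>) = - 1"
proof -
  let ?K = "kernel l m"
  let ?S = "\<lambda>d x e. if e = d then x else (0 :: 'a)"
  let ?R = "\<lambda>x e. if e = 0 then x else if e = 3 then \<eta> * \<phi> v x else 0"
  have single1: "sandwich l m (?S 1 x) 3 = 0"
    "sandwich l m (?S 1 x) 1 = \<theta> * \<phi> u (sandwich l m (?S 1 x) 0)" for x
    using code[of "?S 1 x"] by auto
  have single2: "sandwich l m (?S 2 x) 3 = 0"
    "sandwich l m (?S 2 x) 1 = \<theta> * \<phi> u (sandwich l m (?S 2 x) 0)" for x
    using code[of "?S 2 x"] by auto
  have pair: "sandwich l m (?R x) 3 = 0"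
    "sandwich l m (?R x) 1 = \<theta> * \<phi> u (sandwich l m (?R x) 0)" for x
    using code[of "?R x"] by auto
  have K13: "?K 1 3 i = 0" for i
    using single1(1) unfolding sandwich_single by (rule phi_indep)
  have K23: "?K 2 3 i = 0" for i
    using single2(1) unfolding sandwich_single by (rule phi_indep)
  have K11: "?K 1 1 i = \<theta> * \<phi> u (?K 1 0 (i - u))" for i
    using single1(2) unfolding sandwich_single by (rule coeff_eq_twist)
  have K21: "?K 2 1 i = \<theta> * \<phi> u (?K 2 0 (i - u))" for i
    using single2(2) unfolding sandwich_single by (rule coeff_eq_twist)
  have three: "(3::5) \<noteq> 0"
    by simp
  have K03: "?K 0 3 i + ?K 3 3 (i - v) * \<phi> (i - v) \<eta> = 0" for i
    using pair(1) unfolding sandwich_pair[OF three] by (rule phi_indep)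
  have K01: "?K 0 1 i + ?K 3 1 (i - v) * \<phi> (i - v) \<eta> =
      \<theta> * \<phi> u (?K 0 0 (i - u) + ?K 3 0 (i - u - v) * \<phi> (i - u - v) \<eta>)" for i
    using pair(2) unfolding sandwich_pair[OF three]
    by (rule coeff_eq_twist[where b = "\<lambda>i. ?K 0 0 i + ?K 3 0 (i - v) * \<phi> (i - v) \<eta>"])
  define S where "S = {i. l i \<noteq> 0}"
  define T where "T = {i. m (- i) \<noteq> 0}"
  define P where "P = (\<lambda>d. {i \<in> S. i + d \<in> T})"
  have P: "?K d r i \<noteq> 0 \<longleftrightarrow> i \<in> P e" if "e = d - r" for d r e i
    unfolding that by (simp add: kernel_eq_0_iff P_def S_def T_def del: minus_add_distrib)
  have PK: "?K 1 1 i \<noteq> 0 \<longleftrightarrow> i \<in> P 0" "?K 0 0 i \<noteq> 0 \<longleftrightarrow> i \<in> P 0" "?K 3 3 i \<noteq> 0 \<longleftrightarrow> i \<in> P 0"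
    "?K 1 0 i \<noteq> 0 \<longleftrightarrow> i \<in> P 1" "?K 2 1 i \<noteq> 0 \<longleftrightarrow> i \<in> P 1"
    "?K 2 0 i \<noteq> 0 \<longleftrightarrow> i \<in> P 2" "?K 0 3 i \<noteq> 0 \<longleftrightarrow> i \<in> P 2"
    "?K 1 3 i \<noteq> 0 \<longleftrightarrow> i \<in> P 3" "?K 3 0 i \<noteq> 0 \<longleftrightarrow> i \<in> P 3"
    "?K 2 3 i \<noteq> 0 \<longleftrightarrow> i \<in> P 4" "?K 0 1 i \<noteq> 0 \<longleftrightarrow> i \<in> P 4" for i
    by (rule P, simp)+
  have P3: "P 3 = {}" and P4: "P 4 = {}"
    using K13 K23 PK by blast+
  \<comment> \<open>The terms with differences \<open>0 - 1 = 4\<close> and \<open>3 - 0 = 3\<close>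
    vanish.\<close>
  have K31: "?K 3 1 (i - v) * \<phi> (i - v) \<eta> = \<theta> * \<phi> u (?K 0 0 (i - u))" for i
    using K01[of i] PK(9)[of "i - u - v"] PK(11)[of i] P3 P4 by simp
  have P01: "i \<in> P 0 \<longleftrightarrow> i - u \<in> P 1" for i
    using K11[of i] theta by (subst PK(1)[symmetric], subst PK(4)[symmetric]) simp
  have P12: "i \<in> P 1 \<longleftrightarrow> i - u \<in> P 2" for i
    using K21[of i] theta by (subst PK(5)[symmetric], subst PK(6)[symmetric]) simp
  have P20: "i \<in> P 2 \<longleftrightarrow> i - v \<in> P 0" for i
    using K03[of i] eta by (subst PK(7)[symmetric], subst PK(3)[symmetric]) auto
  have shift: "card X = card Y" if "\<And>i. i \<in> X \<longleftrightarrow> i - w \<in> Y" for X Y :: "5 set" and w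
    by (rule bij_betw_same_card[of "\<lambda>i. i - w"], rule bij_betwI[of _ _ _ "\<lambda>i. i + w"])
      (use that in auto)
  have ST: "S \<noteq> {}" "T \<noteq> {}"
    using l m by (auto simp: S_def T_def intro: exI[of _ "- j0"])
  have nonempty: "P 0 \<noteq> {} \<and> P 1 \<noteq> {} \<and> P 2 \<noteq> {}"
  proof -
    obtain i j where "i \<in> S" "j \<in> T"
      using ST by blast
    then have "i \<in> P (j - i)"
      by (simp add: P_def)
    moreover have "j - i \<in> {0, 1, 2, 3, 4}"
      using UNIV_5 by blast
    ultimately have "P 0 \<noteq> {} \<or> P 1 \<noteq> {} \<or> P 2 \<noteq> {}"
      using P3 P4 by auto
    moreover have "P 0 \<noteq> {} \<longleftrightarrow> P 1 \<noteq> {}" "P 1 \<noteq> {} \<longleftrightarrow> P 2 \<noteq> {}"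
      using shift[OF P01] shift[OF P12] by (metis card_eq_0_iff finite_code)+
    ultimately show ?thesis
      by blast
  qed
  have "card S = 1 \<or> card T = 1"
  proof -
    have "card (P 1) = card (P 0)" "card (P 2) = card (P 0)"
      using shift[OF P01] shift[OF P12] by simp_all
    then show ?thesis
      using card_eq_1_of_three_differences[of 0 1 2 3 4 S T, OF UNIV_5] P3 P4 ST
      by (simp add: P_def)
  qed
  then show ?thesis
  proof
    assume "card S = 1"
    then obtain i where S: "S = {i}"
      by (auto simp: card_1_singleton_iff)
    then have "P d \<subseteq> {i}" for d
      by (auto simp: P_def)
    with nonempty have Pi: "P 0 = {i}" "P 1 = {i}" "P 2 = {i}"
      by blast+
    have u: "u = 0" and v: "v = 0"
      using P01[of i] P20[of i] Pi by auto
    define M where "M = (\<lambda>d. \<phi> i (m (d - i)))"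
    have K: "?K d r i = l i * \<phi> d (M (r - d))" for d r
      by (simp add: kernel_def M_def phi_phi algebra_simps)
    have li: "l i \<noteq> 0"
      using S by (auto simp: S_def)
    have "(\<Prod>j\<in>UNIV. \<phi> j (\<phi> i \<eta>)) = - 1"
    proof (rule norm_minus_1_of_left_twist)
      show "\<phi> 1 (M 0) = \<theta> * \<phi> 1 (M 4)"
        using K11[of i] li by (simp add: u K phi_0 numerals_5)
      show "\<phi> 2 (M 4) = \<theta> * \<phi> 2 (M 3)"
        using K21[of i] li by (simp add: u K phi_0 numerals_5)
      show "M 3 = - (\<phi> i \<eta> * \<phi> 3 (M 0))"
        using cancel_common_factor[of "M 3" "l i" "\<phi> 3 (M 0)" "\<phi> i \<eta>"] K03[of i] li
        by (simp add: v K phi_0 numerals_5 mult_ac)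
      show "\<phi> i \<eta> * \<phi> 3 (M 3) = \<theta> * M 0"
        using K31[of i] li by (simp add: u v K phi_0 numerals_5 mult_ac)
      show "M 0 \<noteq> 0"
        using PK(2)[of i] Pi li by (simp add: K)
    qed
    then show ?thesis
      by (simp add: prod_phi_phi)
  next
    assume "card T = 1"
    then obtain j where T: "T = {j}"
      by (auto simp: card_1_singleton_iff)
    then have "P d \<subseteq> {j - d}" for d
      by (auto simp: P_def)
    with nonempty have Pj: "P 0 = {j - 0}" "P 1 = {j - 1}" "P 2 = {j - 2}"
      by blast+
    have "j - u = j - 1" "j - 2 - v = j"
      using P01[of j] P20[of "j - 2"] Pj by auto
    then have "u + - 1 = 0" "v + 2 = 0"
      by (simp_all add: algebra_simps)
    then have u: "u = 1" and v: "v = 3"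
      unfolding eq_neg_iff_add_eq_0[symmetric] by simp_all
    define X where "X = \<phi> j (m (- j))"
    have X: "X \<noteq> 0"
      using T by (auto simp: X_def T_def)
    have K: "?K d r i = l i * \<phi> r X" if "i + d = j + r" for d r i
    proof -
      have "r - i - d = - j" "i + d = r + j"
        using that by (simp_all add: algebra_simps)
      then show ?thesis
        by (simp add: kernel_def X_def phi_phi)
    qed
    have idx: "j - 1 - 1 = j - 2" "j - 2 - 3 = j" "j + 1 - 3 = j - 2" "j + 1 - 1 = j"
      by (simp_all add: algebra_simps)
    have eta: "\<phi> (j - 2) \<eta> = \<phi> 3 (\<phi> j \<eta>)"
      unfolding phi_phi by (rule arg_cong[of _ _ "\<lambda>i. \<phi> i \<eta>"], simp add: algebra_simps)+
    have "(\<Prod>i\<in>UNIV. \<phi> i (\<phi> j \<eta>)) = - 1"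
    proof (rule norm_minus_1_of_right_twist)
      have "?K 1 1 j = l j * \<phi> 1 X" "?K 1 0 (j - 1) = l (j - 1) * \<phi> 0 X"
        by (rule K; simp add: algebra_simps)+
      then show "l j = \<theta> * \<phi> 1 (l (j - 1))"
        using K11[of j] X by (simp add: u idx phi_mult phi_phi)
      have "?K 2 1 (j - 1) = l (j - 1) * \<phi> 1 X" "?K 2 0 (j - 2) = l (j - 2) * \<phi> 0 X"
        by (rule K; simp add: algebra_simps)+
      then show "l (j - 1) = \<theta> * \<phi> 1 (l (j - 2))"
        using K21[of "j - 1"] X by (simp add: u idx phi_mult phi_phi)
      have "?K 0 3 (j - 2) = l (j - 2) * \<phi> 3 X" "?K 3 3 j = l j * \<phi> 3 X"
        by (rule K; simp add: algebra_simps)+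
      then show "l (j - 2) = - (l j * \<phi> j \<eta>)"
        using K03[of "j - 2"] X by (intro cancel_common_factor[of _ "\<phi> 3 X"]) (simp_all add: v idx)
      have "?K 3 1 (j - 2) = l (j - 2) * \<phi> 1 X" "?K 0 0 j = l j * \<phi> 0 X"
        by (rule K; simp add: algebra_simps)+
      \<comment> \<open>At index \<open>j + 1\<close> the shifts by \<open>v = 3\<close> and
        \<open>u = 1\<close> lead to \<open>j - 2\<close> and \<open>j\<close>.\<close>
      then show "l (j - 2) * \<phi> 3 (\<phi> j \<eta>) = \<theta> * \<phi> 1 (l j)"
        using K31[of "j + 1"] X by (simp add: u v idx eta phi_mult phi_phi)
      show "l j \<noteq> 0"
        using Pj by (auto simp: P_def S_def)
    qed
    then show ?thesis
      by (simp add: prod_phi_phi)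
  qed
qed

section \<open>Normalising the ratio of the two Frobenius exponents\<close>

lemma qmap_expand:
  "qmap a x = a 0 * x + a 1 * \<phi> 1 x + a 2 * \<phi> 2 x + a 3 * \<phi> 3 x + a 4 * \<phi> 4 x"
  unfolding qmap_def UNIV_5 by (simp add: phi_0 add_ac)

text \<open>Replacing \<open>m j\<close> by \<open>m (j + w)\<close> composes \<open>qmap m\<close>
  with \<open>\<phi> (- w)\<close> on the right, which only relabels the coefficients of the
  composite.\<close>

lemma sandwich_shift: "sandwich l (\<lambda>j. m (j + w)) b r = sandwich l m b (r + w)"
  by (simp add: sandwich_def kernel_def algebra_simps)

text \<open>Serves the case \<open>w = 3\<close>, where the shift exchanges the first and the
  twisted coefficient of the target code.\<close>

lemma twist_inverse:
  assumes "x = \<theta> * \<phi> u y" "\<theta> \<noteq> 0"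
  shows "y = \<phi> (- u) (inverse \<theta>) * \<phi> (- u) x"
  using assms by (simp add: phi_phi phi_0 mult.assoc[symmetric] flip: phi_mult)

text \<open>Here \<open>w\<close> stands for t/s modulo 5. Comparing coefficients turns the identity
  of maps into the hypothesis of \<open>norm_of_sandwich_k2\<close>, directly for
  \<open>w = 2\<close> and after a shift for \<open>w = 3\<close>.\<close>

lemma equivalence_norm_k2:
  fixes u v w :: 5
  assumes l: "l i0 \<noteq> 0" and m: "m j0 \<noteq> 0" and eta: "\<eta> \<noteq> 0" and theta: "\<theta> \<noteq> 0"
    and w: "w = 2 \<or> w = 3"
    and code: "\<And>b0 b1. \<exists>c0 c1. \<forall>x.
      qmap l (b0 * qmap m x + b1 * \<phi> 1 (qmap m x) + \<eta> * \<phi> v b0 * \<phi> 2 (qmap m x)) =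
      c0 * x + c1 * \<phi> w x + \<theta> * \<phi> u c0 * \<phi> (2 * w) x"
  shows "(\<Prod>i\<in>UNIV. \<phi> i \<eta>) = 1"
proof -
  have coeffs: "\<exists>c0 c1. \<forall>x. qmap (sandwich l m b) x = c0 * x + c1 * \<phi> w x + \<theta> * \<phi> u c0 * \<phi> (2 * w) x"
    if "b 2 = \<eta> * \<phi> v (b 0)" "b 3 = 0" "b 4 = 0" for b
    using code[of "b 0" "b 1"] unfolding qmap_sandwich[symmetric] qmap_expand[of b] by (simp add: that)
  from w show ?thesis
  proof
    assume w: "w = 2"
    show ?thesis
    proof (rule norm_of_sandwich_k2[where l = l and m = m, OF l m eta theta])
      fix b :: "5 \<Rightarrow> 'a" assume "b 2 = \<eta> * \<phi> v (b 0)" "b 3 = 0" "b 4 = 0"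
      then obtain c0 c1 where
        "\<And>x. qmap (sandwich l m b) x = c0 * x + c1 * \<phi> 2 x + \<theta> * \<phi> u c0 * \<phi> 4 x"
        using coeffs[of b] by (auto simp: w)
      then have "sandwich l m b = (\<lambda>i. if i = 0 then c0 else if i = 2 then c1 else if i = 4 then \<theta> * \<phi> u c0 else 0)"
        by (intro qmap_inject) (simp add: qmap_expand)
      then show "sandwich l m b 1 = 0 \<and> sandwich l m b 3 = 0 \<and>
          sandwich l m b 4 = \<theta> * \<phi> u (sandwich l m b 0)"
        by simp
    qed
  next
    assume w: "w = 3"
    \<comment> \<open>Composing with the inverse of \<open>\<phi> 1\<close> moves the exponents 0, 3, 1 to 4, 2, 0, as for \<open>w = 2\<close>
      with the twist reversed.\<close>
    let ?m = "\<lambda>j. m (j + 1)"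
    show ?thesis
    proof (rule norm_of_sandwich_k2[where l = l and m = ?m and u = "- u" and \<theta> = "\<phi> (- u) (inverse \<theta>)", OF l _ eta])
      show "?m (j0 - 1) \<noteq> 0" "\<phi> (- u) (inverse \<theta>) \<noteq> 0"
        using m theta by simp_all
      fix b :: "5 \<Rightarrow> 'a" assume "b 2 = \<eta> * \<phi> v (b 0)" "b 3 = 0" "b 4 = 0"
      then obtain c0 c1 where
        "\<And>x. qmap (sandwich l m b) x = c0 * x + c1 * \<phi> 3 x + \<theta> * \<phi> u c0 * \<phi> 1 x"
        using coeffs[of b] by (auto simp: w numerals_5)
      then have "sandwich l m b = (\<lambda>i. if i = 0 then c0 else if i = 3 then c1 else if i = 1 then \<theta> * \<phi> u c0 else 0)"
        by (intro qmap_inject) (simp add: qmap_expand)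
      then show "sandwich l ?m b 1 = 0 \<and> sandwich l ?m b 3 = 0 \<and>
          sandwich l ?m b 4 = \<phi> (- u) (inverse \<theta>) * \<phi> (- u) (sandwich l ?m b 0)"
        unfolding sandwich_shift using twist_inverse[OF refl theta, where u = u and y = c0] by (simp add: numerals_5)
    qed
  qed
qed

lemma equivalence_norm_k3:
  fixes u v w :: 5
  assumes l: "l i0 \<noteq> 0" and m: "m j0 \<noteq> 0" and eta: "\<eta> \<noteq> 0" and theta: "\<theta> \<noteq> 0"
    and w: "w = 2 \<or> w = 3"
    and code: "\<And>b0 b1 b2. \<exists>c0 c1 c2. \<forall>x.
      qmap l (b0 * qmap m x + b1 * \<phi> 1 (qmap m x) + b2 * \<phi> 2 (qmap m x) +
        \<eta> * \<phi> v b0 * \<phi> 3 (qmap m x)) =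
      c0 * x + c1 * \<phi> w x + c2 * \<phi> (2 * w) x + \<theta> * \<phi> u c0 * \<phi> (3 * w) x"
  shows "(\<Prod>i\<in>UNIV. \<phi> i \<eta>) = - 1"
proof -
  have coeffs: "\<exists>c0 c1 c2. \<forall>x. qmap (sandwich l m b) x =
      c0 * x + c1 * \<phi> w x + c2 * \<phi> (2 * w) x + \<theta> * \<phi> u c0 * \<phi> (3 * w) x"
    if "b 3 = \<eta> * \<phi> v (b 0)" "b 4 = 0" for b
    using code[of "b 0" "b 1" "b 2"] unfolding qmap_sandwich[symmetric] qmap_expand[of b]
    by (simp add: that)
  from w show ?thesis
  proof
    assume w: "w = 2"
    show ?thesis
    proof (rule norm_of_sandwich_k3[where l = l and m = m, OF l m eta theta])
      fix b :: "5 \<Rightarrow> 'a" assume "b 3 = \<eta> * \<phi> v (b 0)" "b 4 = 0"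
      then obtain c0 c1 c2 where
        "\<And>x. qmap (sandwich l m b) x = c0 * x + c1 * \<phi> 2 x + c2 * \<phi> 4 x + \<theta> * \<phi> u c0 * \<phi> 1 x"
        using coeffs[of b] by (auto simp: w numerals_5)
      then have "sandwich l m b = (\<lambda>i. if i = 0 then c0 else if i = 2 then c1 else if i = 4 then c2
          else if i = 1 then \<theta> * \<phi> u c0 else 0)"
        by (intro qmap_inject) (simp add: qmap_expand)
      then show "sandwich l m b 3 = 0 \<and> sandwich l m b 1 = \<theta> * \<phi> u (sandwich l m b 0)"
        by simp
    qed
  next
    assume w: "w = 3"
    \<comment> \<open>Composing with \<open>\<phi> 1\<close> moves the exponents 0, 3, 1, 4 to 1, 4, 2, 0.\<close>
    let ?m = "\<lambda>j. m (j + 4)"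
    show ?thesis
    proof (rule norm_of_sandwich_k3[where l = l and m = ?m and u = "- u" and \<theta> = "\<phi> (- u) (inverse \<theta>)", OF l _ eta])
      show "?m (j0 - 4) \<noteq> 0" "\<phi> (- u) (inverse \<theta>) \<noteq> 0"
        using m theta by simp_all
      fix b :: "5 \<Rightarrow> 'a" assume "b 3 = \<eta> * \<phi> v (b 0)" "b 4 = 0"
      then obtain c0 c1 c2 where
        "\<And>x. qmap (sandwich l m b) x = c0 * x + c1 * \<phi> 3 x + c2 * \<phi> 1 x + \<theta> * \<phi> u c0 * \<phi> 4 x"
        using coeffs[of b] by (auto simp: w numerals_5)
      then have "sandwich l m b = (\<lambda>i. if i = 0 then c0 else if i = 3 then c1 else if i = 1 then c2
          else if i = 4 then \<theta> * \<phi> u c0 else 0)"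
        by (intro qmap_inject) (simp add: qmap_expand)
      then show "sandwich l ?m b 3 = 0 \<and>
          sandwich l ?m b 1 = \<phi> (- u) (inverse \<theta>) * \<phi> (- u) (sandwich l ?m b 0)"
        unfolding sandwich_shift using twist_inverse[OF refl theta, where u = u and y = c0] by (simp add: numerals_5)
    qed
  qed
qed

end

section \<open>Finite fields, residues modulo 5 and field homomorphisms\<close>

lemma power_CARD_eq_same:
  fixes x :: "'a :: {field, finite}"
  shows "x ^ CARD('a) = x"
proof (cases "x = 0")
  case False
  define P where "P = \<Prod>(UNIV - {0 :: 'a})"
  have "P = (\<Prod>y\<in>UNIV - {0}. x * y)"
    unfolding P_def by (rule prod.reindex_bij_witness[of _ "\<lambda>y. x * y" "\<lambda>y. y / x"]) (use False in auto)
  also have "\<dots> = x ^ (CARD('a) - 1) * P"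
    by (simp add: prod.distrib P_def)
  finally have "x ^ (CARD('a) - 1) = 1"
    by (simp add: P_def)
  then have "x ^ Suc (CARD('a) - 1) = x"
    by (simp only: power_Suc mult_1_right)
  moreover have "Suc (CARD('a) - 1) = CARD('a)"
    by (simp add: finite_UNIV_card_ge_0)
  ultimately show ?thesis
    by metis
qed simp

text \<open>Translation by 1 permutes the ring, so it leaves the sum of all elements unchanged; it
  also adds the cardinality to that sum.\<close>

lemma CHAR_dvd_CARD: "CHAR('a :: {ring_1, finite}) dvd CARD('a)"
proof -
  have "(\<Sum>y\<in>UNIV. y + 1 :: 'a) = (\<Sum>y\<in>UNIV. y)"
    by (rule sum.reindex_bij_witness[of _ "\<lambda>y. y - 1" "\<lambda>y. y + 1"]) auto
  then have "of_nat CARD('a) = (0 :: 'a)"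
    by (simp add: sum.distrib)
  then show ?thesis
    by (simp add: of_nat_eq_0_iff_char_dvd)
qed

lemma of_nat_5_eq_iff: "(of_nat m :: 5) = of_nat n \<longleftrightarrow> [m = n] (mod 5)"
  by (simp add: of_nat_eq_iff_cong_CHAR)

lemma surj_of_nat_5: "\<exists>n. (i :: 5) = of_nat n"
proof -
  have "i \<in> {of_nat 0, of_nat 1, of_nat 2, of_nat 3, of_nat 4}"
    using UNIV_5 by auto
  then show ?thesis
    by blast
qed

lemma map_poly_hom_eval:
  fixes \<sigma> :: "'a :: field \<Rightarrow> 'a"
  assumes "\<And>x y. \<sigma> (x + y) = \<sigma> x + \<sigma> y" "\<And>x y. \<sigma> (x * y) = \<sigma> x * \<sigma> y"
  shows "poly (map_poly \<sigma> f) (\<sigma> z) = \<sigma> (poly f z)"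
proof -
  have "\<sigma> 0 = 0"
    using assms(1)[of 0 0] by (metis add.right_neutral add_left_cancel)
  then show ?thesis
    by (induction f) (simp_all add: map_poly_pCons assms)
qed

lemma hom_power:
  fixes \<sigma> :: "'a :: field \<Rightarrow> 'a"
  assumes "\<And>x y. \<sigma> (x * y) = \<sigma> x * \<sigma> y" "\<sigma> 1 = 1"
  shows "\<sigma> (x ^ n) = \<sigma> x ^ n"
  by (induction n) (simp_all add: assms)

section \<open>Frobenius maps of the field with q^5 elements\<close>

locale field_q5 =
  fixes q :: nat and ty :: "'a :: {field, finite} itself"
  assumes primepow_q: "primepow q" and CARD_q: "CARD('a) = q ^ 5"
begin

lemma power_q_plus: "(x + y :: 'a) ^ q ^ n = x ^ q ^ n + y ^ q ^ n"
proof -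
  obtain p k where p: "prime p" "q = p ^ k"
    using primepow_q by (auto simp: primepow_def)
  have pos: "CHAR('a) > 0"
    by (rule finite_imp_CHAR_pos) simp
  then have prime: "prime CHAR('a)"
    by (rule prime_CHAR_semidom)
  have "CHAR('a) dvd p ^ (k * 5)"
    using CHAR_dvd_CARD[where 'a = 'a] by (simp add: CARD_q p power_mult)
  then have "CHAR('a) dvd p"
    using prime prime_dvd_power_nat by blast
  then have "CHAR('a) = p"
    using prime p primes_dvd_imp_eq by blast
  then have "q ^ n = CHAR('a) ^ (k * n)"
    by (simp add: p power_mult)
  with prime show ?thesis
    by (rule freshmans_dream')
qed

lemma power_q5: "x ^ q ^ 5 = (x :: 'a)"
  using power_CARD_eq_same[of x] by (simp add: CARD_q)

lemma power_q_mod: "x ^ q ^ n = (x :: 'a) ^ q ^ (n mod 5)"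
proof -
  have "x ^ q ^ (5 * k + m) = x ^ q ^ m" for k m
  proof (induction k)
    case (Suc k)
    have "x ^ q ^ (5 * Suc k + m) = (x ^ q ^ 5) ^ q ^ (5 * k + m)"
      by (simp add: power_add mult.assoc flip: power_mult)
    then show ?case
      by (simp add: power_q5 Suc)
  qed simp
  from this[of "n div 5" "n mod 5"] show ?thesis
    by simp
qed

lemma power_q_cong: "[m = n] (mod 5) \<Longrightarrow> x ^ q ^ m = (x :: 'a) ^ q ^ n"
  using power_q_mod[of x m] power_q_mod[of x n] by (simp add: cong_def)

text \<open>The modulus vanishes at every element of the field.\<close>

lemma poly_red: "poly (red q f) x = poly f (x :: 'a)"
proof -
  let ?m = "monom 1 (q ^ 5) - monom 1 1 :: 'a poly"
  have "poly f x = poly (f div ?m * ?m + f mod ?m) x"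
    by (simp only: div_mult_mod_eq)
  also have "\<dots> = poly (red q f) x"
    unfolding red_def poly_add poly_mult by (simp add: poly_monom power_q5)
  finally show ?thesis
    by simp
qed

text \<open>The least representative only serves to pick a natural number for the residue class; by
  \<open>frob_of_nat\<close> every representative gives the same map.\<close>

definition frob :: "nat \<Rightarrow> 5 \<Rightarrow> 'a \<Rightarrow> 'a" where
  "frob s i x = x ^ q ^ (s * (LEAST n. of_nat n = i))"

lemma frob_of_nat: "frob s (of_nat n) x = x ^ q ^ (s * n)"
proof -
  have "of_nat (LEAST m. of_nat m = (of_nat n :: 5)) = (of_nat n :: 5)"
    by (rule LeastI) simp
  then have "[(LEAST m. of_nat m = (of_nat n :: 5)) = n] (mod 5)"
    unfolding of_nat_5_eq_iff .
  then show ?thesis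
    unfolding frob_def by (intro power_q_cong cong_scalar_left)
qed

text \<open>As \<open>s\<close> is invertible modulo 5, the reduced exponents \<open>e i\<close> are
  distinct. The combination is thus a polynomial of degree at most q^4 with q^5 zeros, hence zero,
  and \<open>c j\<close> is one of its coefficients.\<close>

lemma frob_indep:
  assumes s: "coprime s 5" and zero: "\<And>x. (\<Sum>i\<in>UNIV. c i * frob s i x) = 0"
  shows "c j = 0"
proof -
  define e where "e = (\<lambda>i :: 5. s * (LEAST n. of_nat n = i) mod 5)"
  have of_nat_Least: "of_nat (LEAST n. of_nat n = i) = i" for i :: 5
    by (rule LeastI_ex) (metis surj_of_nat_5)
  have inj: "e i = e j \<longleftrightarrow> i = j" for i j
  proof
    assume "e i = e j"
    then have "[s * (LEAST n. of_nat n = i) = s * (LEAST n. of_nat n = j)] (mod 5)"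
      by (simp add: e_def cong_def)
    then have "[(LEAST n. of_nat n = i) = (LEAST n. of_nat n = j)] (mod 5)"
      using s by (simp add: cong_mult_lcancel_nat)
    then show "i = j"
      unfolding of_nat_5_eq_iff[symmetric] of_nat_Least .
  qed simp
  have q: "q > 1"
    using primepow_gt_Suc_0[OF primepow_q] by simp
  define p where "p = (\<Sum>i\<in>UNIV. monom (c i) (q ^ e i))"
  have "degree p \<le> q ^ 4"
    unfolding p_def
  proof (rule degree_sum_le)
    fix i
    have "e i \<le> 4"
      using mod_less_divisor[of 5 "s * (LEAST n. of_nat n = i)"] by (simp add: e_def)
    then have "q ^ e i \<le> q ^ 4"
      using q by (intro power_increasing) auto
    then show "degree (monom (c i) (q ^ e i)) \<le> q ^ 4"
      using degree_monom_le order_trans by blast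
  qed simp
  also have "q ^ 4 < q ^ 5"
    using q by (intro power_strict_increasing) auto
  finally have "degree p < CARD('a)"
    by (simp add: CARD_q)
  moreover have "poly p x = 0" for x
    using zero[of x] by (simp add: p_def e_def poly_sum poly_monom frob_def power_q_mod[symmetric])
  ultimately have "p = 0"
    by (intro poly_eqI_degree[of UNIV]) auto
  moreover have "q ^ e i = q ^ e j \<longleftrightarrow> i = j" for i
    using inj[of i j] power_inject_exp[OF q] by simp
  then have "coeff p (q ^ e j) = (\<Sum>i\<in>UNIV. if i = j then c i else 0)"
    unfolding p_def coeff_sum coeff_monom by simp
  ultimately show ?thesis
    by simp
qed

lemma cyclic5_frob:
  assumes "coprime s 5"
  shows "cyclic5_automorphisms (frob s)"
proof
  fix i j :: 5 and x y :: 'a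
  obtain m n where ij: "i = of_nat m" "j = of_nat n"
    using surj_of_nat_5 by metis
  show "frob s 0 x = x"
    using frob_of_nat[of s 0 x] by simp
  have "frob s (of_nat (m + n)) x = frob s (of_nat m) (frob s (of_nat n) x)"
    unfolding frob_of_nat by (simp add: distrib_left power_add mult.commute flip: power_mult)
  then show "frob s (i + j) x = frob s i (frob s j x)"
    by (simp add: ij)
  show "frob s i (x + y) = frob s i x + frob s i y" "frob s i (x * y) = frob s i x * frob s i y"
    by (simp_all add: frob_def power_q_plus power_mult_distrib)
  show "c k = 0" if "\<And>x. (\<Sum>i\<in>UNIV. c i * frob s i x) = 0" for c k
    using frob_indep[OF assms that] .
qed

lemma norm5_eq_prod:
  shows "norm5 q s (x :: 'a) = (\<Prod>i\<in>UNIV. frob s i x)"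
proof -
  have eq: "{..<5 :: nat} = {0, 1, 2, 3, 4}"
    by auto
  have "norm5 q s x = (\<Prod>i<5. frob s (of_nat i) x)"
    by (simp add: norm5_def power_sum frob_of_nat mult.commute)
  also have "\<dots> = (\<Prod>i\<in>UNIV. frob s i x)"
    unfolding UNIV_5 eq by simp
  finally show ?thesis .
qed

text \<open>The index is h/s modulo 5.\<close>

lemma power_q_frob:
  assumes "coprime s 5"
  obtains u where "\<And>x :: 'a. x ^ q ^ h = frob s u x"
proof -
  obtain r where "[s * r = 1] (mod 5)"
    using cong_solve_coprime_nat[OF assms] by auto
  then have "[s * r * h = 1 * h] (mod 5)"
    by (rule cong_scalar_right)
  then have "x ^ q ^ h = frob s (of_nat (r * h)) x" for x
    unfolding frob_of_nat by (intro power_q_cong) (simp add: cong_sym mult.assoc)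
  then show ?thesis
    by (rule that)
qed

lemma qpoly_frob:
  assumes "coprime s 5" "L \<in> qpolys q"
  shows "\<exists>l. \<forall>x :: 'a. poly L x = (\<Sum>i\<in>UNIV. l i * frob s i x)"
proof -
  obtain a where L: "L = (\<Sum>i<5. monom (a i) (q ^ i))"
    using assms(2) by (auto simp: qpolys_def)
  have "\<exists>u. \<forall>x :: 'a. x ^ q ^ i = frob s u x" for i
    using power_q_frob[OF assms(1), of i] by metis
  then obtain u where u: "\<And>i x. x ^ q ^ i = frob s (u i) x"
    by metis
  \<comment> \<open>The coefficient at \<open>j\<close> collects all \<open>a i\<close> with
    \<open>u i = j\<close>.\<close>
  have "poly L x = (\<Sum>j\<in>UNIV. (\<Sum>i<5. if j = u i then a i else 0) * frob s j x)" for x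
  proof -
    have "poly L x = (\<Sum>i<5. a i * frob s (u i) x)"
      by (simp add: L poly_sum poly_monom u)
    also have "\<dots> = (\<Sum>i<5. \<Sum>j\<in>UNIV. if j = u i then a i * frob s j x else 0)"
      by simp
    also have "\<dots> = (\<Sum>j\<in>UNIV. \<Sum>i<5. if j = u i then a i * frob s j x else 0)"
      by (rule sum.swap)
    also have "\<dots> = (\<Sum>j\<in>UNIV. (\<Sum>i<5. if j = u i then a i else 0) * frob s j x)"
      by (simp add: sum_distrib_right if_distrib[of "\<lambda>y. y * _"] cong: if_cong)
    finally show ?thesis .
  qed
  then show ?thesis
    by (intro exI allI)
qed

lemma permutation_qpoly_frob:
  assumes "coprime s 5" "permutation_qpoly q L"
  obtains l i where "l i \<noteq> 0" "\<And>x :: 'a. poly L x = (\<Sum>i\<in>UNIV. l i * frob s i x)"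
proof -
  obtain l where l: "\<And>x :: 'a. poly L x = (\<Sum>i\<in>UNIV. l i * frob s i x)"
    using qpoly_frob[OF assms(1)] assms(2) by (auto simp: permutation_qpoly_def)
  moreover have "\<exists>i. l i \<noteq> 0"
  proof (rule ccontr)
    assume "\<nexists>i. l i \<noteq> 0"
    then have "poly L 0 = poly L 1"
      by (simp add: l)
    moreover have "inj (poly L)"
      using assms(2) by (simp add: permutation_qpoly_def bij_is_inj)
    ultimately show False
      by (metis injD zero_neq_one)
  qed
  ultimately show ?thesis
    using that by blast
qed

section \<open>From an equivalence of codes to identities of maps\<close>

text \<open>Evaluation is insensitive to \<open>red\<close>, so membership in the second code
  becomes an identity of functions. As \<open>\<sigma>\<close> is bijective, any tuple
  \<open>b\<close> is the image of some coefficient tuple; the automorphism is absorbed there and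
  survives only in \<open>\<sigma> \<eta>\<close>.\<close>

lemma code_equivalent_eval:
  fixes \<eta> \<theta> :: 'a
  assumes "code_equivalent q (Hcode q k s \<eta> g) (Hcode q k t \<theta> h)"
  obtains L1 L2 \<sigma> where "permutation_qpoly q L1" "permutation_qpoly q L2"
    "bij \<sigma>" "\<And>x y. \<sigma> (x + y) = \<sigma> x + \<sigma> y" "\<And>x y. \<sigma> (x * y) = \<sigma> x * \<sigma> y"
    "\<And>b. \<exists>c. \<forall>x.
      poly L1 ((\<Sum>i<k. b i * poly L2 x ^ q ^ (s * i)) + \<sigma> \<eta> * b 0 ^ q ^ g * poly L2 x ^ q ^ (s * k)) =
      (\<Sum>i<k. c i * x ^ q ^ (t * i)) + \<theta> * c 0 ^ q ^ h * x ^ q ^ (t * k)"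
proof -
  obtain L1 L2 \<rho> \<sigma> where L: "permutation_qpoly q L1" "permutation_qpoly q L2"
    and \<sigma>: "automorphism_on UNIV \<sigma>"
    and image: "Hcode q k t \<theta> h = {red q (pcompose L1 (pcompose (map_poly \<sigma> f) L2)) | f. f \<in> Hcode q k s \<eta> g}"
    using assms unfolding code_equivalent_def by blast
  have bij: "bij \<sigma>" and add: "\<And>x y. \<sigma> (x + y) = \<sigma> x + \<sigma> y" and mult: "\<And>x y. \<sigma> (x * y) = \<sigma> x * \<sigma> y"
    using \<sigma> by (auto simp: automorphism_on_def)
  have surj: "\<sigma> (inv \<sigma> y) = y" for y
    using bij by (simp add: bij_is_surj surj_f_inv_f)
  have zero: "\<sigma> 0 = 0"
    using add[of 0 0] by (metis add.right_neutral add_left_cancel)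
  have "\<sigma> 1 \<noteq> 0"
    using bij zero by (metis bij_pointE zero_neq_one)
  then have one: "\<sigma> 1 = 1"
    using mult[of 1 1] by simp
  have power: "\<sigma> (x ^ n) = \<sigma> x ^ n" for x n
    using mult one by (rule hom_power)
  have sum: "\<sigma> (sum f A) = (\<Sum>i\<in>A. \<sigma> (f i))" for f :: "nat \<Rightarrow> 'a" and A
    by (induction A rule: infinite_finite_induct) (simp_all add: zero add)
  have "\<exists>c. \<forall>x.
      poly L1 ((\<Sum>i<k. b i * poly L2 x ^ q ^ (s * i)) + \<sigma> \<eta> * b 0 ^ q ^ g * poly L2 x ^ q ^ (s * k)) =
      (\<Sum>i<k. c i * x ^ q ^ (t * i)) + \<theta> * c 0 ^ q ^ h * x ^ q ^ (t * k)" for b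
  proof -
    define a where "a = (\<lambda>i. inv \<sigma> (b i))"
    define f where
      "f = red q ((\<Sum>i<k. monom (a i) (q ^ (s * i))) + monom (\<eta> * a 0 ^ q ^ g) (q ^ (s * k)))"
    have "f \<in> Hcode q k s \<eta> g"
      unfolding f_def Hcode_def by blast
    then have "red q (pcompose L1 (pcompose (map_poly \<sigma> f) L2)) \<in> Hcode q k t \<theta> h"
      unfolding image by blast
    then obtain c where c: "red q (pcompose L1 (pcompose (map_poly \<sigma> f) L2)) =
        red q ((\<Sum>i<k. monom (c i) (q ^ (t * i))) + monom (\<theta> * c 0 ^ q ^ h) (q ^ (t * k)))"
      unfolding Hcode_def by blast
    have "poly (map_poly \<sigma> f) y =
        (\<Sum>i<k. b i * y ^ q ^ (s * i)) + \<sigma> \<eta> * b 0 ^ q ^ g * y ^ q ^ (s * k)" for y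
    proof -
      have "poly (map_poly \<sigma> f) (\<sigma> (inv \<sigma> y)) = \<sigma> (poly f (inv \<sigma> y))"
        using add mult by (rule map_poly_hom_eval)
      then show ?thesis
        by (simp add: f_def poly_red poly_sum poly_monom add mult power sum surj a_def)
    qed
    then have "poly L1 ((\<Sum>i<k. b i * poly L2 x ^ q ^ (s * i)) +
          \<sigma> \<eta> * b 0 ^ q ^ g * poly L2 x ^ q ^ (s * k)) =
        (\<Sum>i<k. c i * x ^ q ^ (t * i)) + \<theta> * c 0 ^ q ^ h * x ^ q ^ (t * k)" for x
      using arg_cong[OF c, of "\<lambda>p. poly p x"] by (simp add: poly_red poly_pcompose poly_sum poly_monom)
    then show ?thesis
      by blast
  qed
  with L bij add mult show ?thesis
    by (rule that)
qed

end

section \<open>The quotient t/s modulo 5 and the contradiction with the norm\<close>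

text \<open>The quotient t/s is a nonzero residue; excluding 1 and -1 leaves 2 and 3.\<close>

lemma cong_2_or_3_times:
  fixes s t :: nat
  assumes "gcd 5 s = 1" "gcd 5 t = 1" "\<not> [int s = int t] (mod 5)" "\<not> [int s = - int t] (mod 5)"
  shows "[t = 2 * s] (mod 5) \<or> [t = 3 * s] (mod 5)"
proof -
  have nonzero: "n mod 5 \<in> {1, 2, 3, 4}" if "gcd 5 n = 1" for n :: nat
  proof -
    have "n mod 5 \<noteq> 0"
      using that gcd_nat.absorb1[of 5 n] by (auto simp: dvd_eq_mod_eq_0)
    moreover have "n mod 5 < 5"
      by simp
    ultimately show ?thesis
      by auto
  qed
  define a b where "a = s mod 5" and "b = t mod 5"
  have ab: "a \<in> {1, 2, 3, 4}" "b \<in> {1, 2, 3, 4}"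
    using nonzero[OF assms(1)] nonzero[OF assms(2)] by (simp_all add: a_def b_def)
  have "a \<noteq> b"
    using assms(3) cong_int_iff[of s t 5] unfolding a_def b_def by (simp add: cong_def)
  moreover have "a + b \<noteq> 5"
  proof
    assume "a + b = 5"
    then have "(s + t) mod 5 = 0"
      unfolding a_def b_def by (metis mod_add_eq mod_self)
    then have "[int s + int t = 0] (mod 5)"
      unfolding cong_def by (metis mod_0 of_nat_0 of_nat_add of_nat_numeral zmod_int)
    then have "[int s + int t - int t = 0 - int t] (mod 5)"
      by (rule cong_diff) (rule cong_refl)
    with assms(4) show False
      by simp
  qed
  ultimately have "b = (2 * a) mod 5 \<or> b = (3 * a) mod 5"
    using ab by auto
  then show ?thesis
    by (simp add: a_def b_def cong_def mod_mult_right_eq)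
qed

theorem theorem4p9:
  fixes q k s t g h :: nat and \<eta> \<theta> :: "'a :: {field, finite}"
  assumes "primepow q" and "CARD('a) = q ^ 5"
    and "s > 0" and "t > 0" and "g > 0" and "h > 0"
    and "gcd 5 s = 1" and "gcd 5 t = 1"
    and "k \<in> {2, 3}"
    and "\<eta> \<noteq> 0" and "\<theta> \<noteq> 0"
    and "norm5 q s \<eta> \<noteq> (- 1) ^ (5 * k)"
    and "norm5 q t \<theta> \<noteq> (- 1) ^ (5 * k)"
    and "\<not> [int s = int t] (mod 5)" and "\<not> [int s = - int t] (mod 5)"
  shows "\<not> code_equivalent q (Hcode q k s \<eta> g) (Hcode q k t \<theta> h)"
proof
  assume equiv: "code_equivalent q (Hcode q k s \<eta> g) (Hcode q k t \<theta> h)"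
  interpret field_q5 q "TYPE('a)"
    using assms(1,2) by (rule field_q5.intro)
  have s: "coprime s 5"
    using assms(7) by (simp add: coprime_iff_gcd_eq_1 gcd.commute)
  interpret cyclic5_automorphisms "frob s :: 5 \<Rightarrow> 'a \<Rightarrow> 'a"
    using s by (rule cyclic5_frob)
  obtain L1 L2 \<sigma> where L: "permutation_qpoly q L1" "permutation_qpoly q L2"
    and \<sigma>: "bij \<sigma>" "\<And>x y. \<sigma> (x + y) = \<sigma> x + \<sigma> y" "\<And>x y. \<sigma> (x * y) = \<sigma> x * \<sigma> y"
    and eval: "\<And>b. \<exists>c. \<forall>x.
      poly L1 ((\<Sum>i<k. b i * poly L2 x ^ q ^ (s * i)) + \<sigma> \<eta> * b 0 ^ q ^ g * poly L2 x ^ q ^ (s * k)) =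
      (\<Sum>i<k. c i * x ^ q ^ (t * i)) + \<theta> * c 0 ^ q ^ h * x ^ q ^ (t * k)"
    by (rule code_equivalent_eval[OF equiv], rule that)
  obtain l i0 where l: "l i0 \<noteq> 0" "\<And>x. poly L1 x = qmap l x"
    using permutation_qpoly_frob[OF s L(1)] unfolding qmap_def by blast
  obtain m j0 where m: "m j0 \<noteq> 0" "\<And>x. poly L2 x = qmap m x"
    using permutation_qpoly_frob[OF s L(2)] unfolding qmap_def by blast
  obtain u where u: "\<And>x :: 'a. x ^ q ^ h = frob s u x"
    by (rule power_q_frob[OF s, of h], rule that)
  obtain v where v: "\<And>x :: 'a. x ^ q ^ g = frob s v x"
    by (rule power_q_frob[OF s, of g], rule that)
  \<comment> \<open>With \<open>w\<close> the quotient of \<open>t\<close> by \<open>s\<close>, both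
    codes are written in the maps \<open>frob s\<close>.\<close>
  obtain w where w: "w = 2 \<or> w = 3" "[t = w * s] (mod 5)"
    using cong_2_or_3_times assms(7,8,14,15) by metis
  have t_frob: "x ^ q ^ (t * i) = frob s (of_nat i * of_nat w) x" for i and x :: 'a
    using frob_of_nat[of s "w * i" x] cong_scalar_right[OF w(2), of i] power_q_cong[of "t * i" "w * s * i" x]
    by (simp add: mult_ac)
  have w5: "(of_nat w :: 5) = 2 \<or> (of_nat w :: 5) = 3"
    using w(1) by auto
  have s_frob: "x ^ q ^ (s * i) = frob s (of_nat i) x" for i and x :: 'a
    by (simp add: frob_of_nat)
  have zero: "\<sigma> 0 = 0"
    using \<sigma>(2)[of 0 0] by (metis add.right_neutral add_left_cancel)
  have inj: "\<sigma> x = \<sigma> y \<longleftrightarrow> x = y" for x y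
    using \<sigma>(1) by (simp add: bij_is_inj inj_eq)
  have one: "\<sigma> 1 = 1"
    using \<sigma>(3)[of 1 1] inj[of 1 0] zero by simp
  have minus_one: "\<sigma> (- 1) = - 1"
    using \<sigma>(2)[of 1 "- 1"] one zero by (metis add.right_inverse minus_unique)
  have eta: "\<sigma> \<eta> \<noteq> 0"
    using inj[of \<eta> 0] zero assms(10) by simp
  have norm: "norm5 q s (\<sigma> \<eta>) = \<sigma> (norm5 q s \<eta>)"
    unfolding norm5_def by (rule hom_power[symmetric, OF \<sigma>(3) one])
  \<comment> \<open>For k = 2 and k = 3 the value \<open>(- 1) ^ (5 * k)\<close> is
    \<open>(- 1) ^ k\<close>. Since \<open>\<sigma>\<close> fixes 1 and -1 and commutes with the
    norm, the condition on \<open>\<eta>\<close> passes to \<open>\<sigma> \<eta>\<close>.\<close>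
  have neq: "norm5 q s (\<sigma> \<eta>) \<noteq> (- 1) ^ k"
    using assms(9,12) inj[of "norm5 q s \<eta>" 1] inj[of "norm5 q s \<eta>" "- 1"]
    by (auto simp: norm one minus_one)
  from assms(9) consider "k = 2" | "k = 3"
    by auto
  then show False
  proof cases
    case 1
    have "(\<Prod>i\<in>UNIV. frob s i (\<sigma> \<eta>)) = 1"
    proof (rule equivalence_norm_k2[where l = l and m = m, OF l(1) m(1) eta assms(11) w5])
      fix b0 b1 :: 'a
      show "\<exists>c0 c1. \<forall>x. qmap l (b0 * qmap m x + b1 * frob s 1 (qmap m x) + \<sigma> \<eta> * frob s v b0 * frob s 2 (qmap m x)) =
          c0 * x + c1 * frob s (of_nat w) x + \<theta> * frob s u c0 * frob s (2 * of_nat w) x"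
        using eval[of "\<lambda>i. if i = 0 then b0 else b1"]
        by (auto simp: 1 lessThan_nat_numeral lessThan_Suc s_frob t_frob u v l(2) m(2) phi_0 add_ac)
    qed
    with neq show False
      by (simp add: 1 norm5_eq_prod)
  next
    case 2
    have "(\<Prod>i\<in>UNIV. frob s i (\<sigma> \<eta>)) = - 1"
    proof (rule equivalence_norm_k3[where l = l and m = m, OF l(1) m(1) eta assms(11) w5])
      fix b0 b1 b2 :: 'a
      show "\<exists>c0 c1 c2. \<forall>x. qmap l (b0 * qmap m x + b1 * frob s 1 (qmap m x) + b2 * frob s 2 (qmap m x) +
            \<sigma> \<eta> * frob s v b0 * frob s 3 (qmap m x)) =
          c0 * x + c1 * frob s (of_nat w) x + c2 * frob s (2 * of_nat w) x +
            \<theta> * frob s u c0 * frob s (3 * of_nat w) x"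
        using eval[of "\<lambda>i. if i = 0 then b0 else if i = 1 then b1 else b2"]
        by (auto simp: 2 lessThan_nat_numeral lessThan_Suc s_frob t_frob u v l(2) m(2) phi_0 add_ac)
    qed
    with neq show False
      by (simp add: 2 norm5_eq_prod)
  qed
qed

end
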